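(* Let $a,b$ be integers with $2\le a\le b-2$ and let $\rho$ be a root of the polynomial $f(x)=x^3-(a+b)x^2+abx-1$. Then the elements of the form \[ -v+(bw+1)\rho-w\rho^2,\qquad v,w\in\mathbb Z,\quad 0\le v\le b-a-1,\quad va\le w\le (v+1)a-1, \] are, up to multiplication by totally positive units of $\mathbb Z[\rho]$, all the indecomposable integers in $\mathbb Z[\rho]$. That is, each of these elements is indecomposable in $\mathbb Z[\rho]$, and every indecomposable integer in $\mathbb Z[\rho]$ is the product of one of them with a totally positive unit.
   Context: The field $K=\mathbb Q(\rho)$ is a totally real cubic field and $\mathbb Z[\rho]$ is an order in it. An element of $K$ is totally positive if all its images under the embeddings $K\to\mathbb R$ are positive. A totally positive $\alpha\in\mathbb Z[\rho]$ is indecomposable in $\mathbb Z[\rho]$ if it cannot be written as $\alpha=\beta+\gamma$ with $\beta,\gamma\in\mathbb Z[\rho]$ totally positive. (The choice $v=w=0$ gives the totally positive unit $\rho$, so units are included.) *)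

theory Defs
  imports "HOL-Computational_Algebra.Polynomial"
begin

definition Z_adjoin :: "'a::field_char_0 \<Rightarrow> 'a set" where
  "Z_adjoin \<rho> = {poly (map_poly of_int p) \<rho> | p :: int poly. True}"

definition Q_adjoin :: "'a::field_char_0 \<Rightarrow> 'a set" where
  "Q_adjoin \<rho> = {poly (map_poly of_rat p) \<rho> / poly (map_poly of_rat q) \<rho> | p q :: rat poly.
                   poly (map_poly of_rat q) \<rho> \<noteq> 0}"

text \<open>Ring homomorphisms from a subfield \<open>K\<close> to the reals (automatically injective).  They are
  represented by functions on the whole type, whose values outside \<open>K\<close> are irrelevant.\<close>

definition real_embedding :: "'a::field_char_0 set \<Rightarrow> ('a \<Rightarrow> real) \<Rightarrow> bool" where
  "real_embedding K \<sigma> \<longleftrightarrow>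
     \<sigma> 1 = 1 \<and> (\<forall>x\<in>K. \<forall>y\<in>K. \<sigma> (x + y) = \<sigma> x + \<sigma> y \<and> \<sigma> (x * y) = \<sigma> x * \<sigma> y)"

definition totally_positive :: "'a::field_char_0 set \<Rightarrow> 'a \<Rightarrow> bool" where
  "totally_positive K \<alpha> \<longleftrightarrow> \<alpha> \<in> K \<and> (\<forall>\<sigma>. real_embedding K \<sigma> \<longrightarrow> \<sigma> \<alpha> > 0)"

definition indecomposable :: "'a::field_char_0 \<Rightarrow> 'a \<Rightarrow> bool" where
  "indecomposable \<rho> \<alpha> \<longleftrightarrow>
     \<alpha> \<in> Z_adjoin \<rho> \<and> totally_positive (Q_adjoin \<rho>) \<alpha> \<and>
     \<not> (\<exists>\<beta>\<in>Z_adjoin \<rho>. \<exists>\<gamma>\<in>Z_adjoin \<rho>.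
          totally_positive (Q_adjoin \<rho>) \<beta> \<and> totally_positive (Q_adjoin \<rho>) \<gamma> \<and> \<alpha> = \<beta> + \<gamma>)"

definition totally_positive_unit :: "'a::field_char_0 \<Rightarrow> 'a \<Rightarrow> bool" where
  "totally_positive_unit \<rho> \<epsilon> \<longleftrightarrow>
     \<epsilon> \<in> Z_adjoin \<rho> \<and> (\<exists>\<eta>\<in>Z_adjoin \<rho>. \<epsilon> * \<eta> = 1) \<and> totally_positive (Q_adjoin \<rho>) \<epsilon>"

definition cubic :: "int \<Rightarrow> int \<Rightarrow> int poly" where
  "cubic a b = [:-1, a * b, -(a + b), 1:]"

definition triangle_elements :: "int \<Rightarrow> int \<Rightarrow> 'a::field_char_0 \<Rightarrow> 'a set" where
  "triangle_elements a b \<rho> =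
     {- of_int v + of_int (b * w + 1) * \<rho> - of_int w * \<rho>\<^sup>2 | v w :: int.
        0 \<le> v \<and> v \<le> b - a - 1 \<and> v * a \<le> w \<and> w \<le> (v + 1) * a - 1}"

end

theory Submission
  imports Defs "HOL-Computational_Algebra.Field_as_Ring"
    "HOL-Computational_Algebra.Polynomial_Factorial"
begin

text \<open>
  The equation of \<open>\<rho>\<close> reads \<open>\<rho> (\<rho> - a) (\<rho> - b) = 1\<close>, so \<open>\<rho>\<close> and \<open>\<kappa> = b \<rho> - \<rho>\<^sup>2 = 1 / (a - \<rho>)\<close> are units, and
  \<open>\<rho>\<close>, \<open>\<kappa>\<^sup>2\<close> are totally positive.  Two simplicial cones matter: \<open>C\<^sub>1\<close> spanned by \<open>1, \<rho>, \<kappa>\<^sup>2\<close> and \<open>C\<^sub>2\<close>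
  spanned by \<open>\<rho>, \<kappa>\<^sup>2, \<rho>\<kappa>\<^sup>2\<close>.  Let \<open>\<psi>\<^sub>1, \<psi>\<^sub>2\<close> be the linear forms with value \<open>a\<close> at the generators of \<open>C\<^sub>1\<close> and
  \<open>C\<^sub>2\<close> respectively; they are integral on \<open>\<int>[\<rho>]\<close>.  Locating the three real roots gives \<open>\<psi>\<^sub>1 \<ge> a\<close> and
  \<open>\<psi>\<^sub>2 > 0\<close> on all totally positive elements.  The elements of the theorem have \<open>\<psi>\<^sub>1 < 2 a\<close>, so they
  are indecomposable.

  Conversely, among all values of \<open>\<psi>\<^sub>1\<close> and \<open>\<psi>\<^sub>2\<close> at unit multiples of an indecomposable \<open>\<alpha>\<close>, take the
  smallest, attained say by \<open>\<psi>\<^sub>i\<close> at \<open>x\<close>.  Each facet of \<open>C\<^sub>i\<close> is shared with a unit translate of the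
  other cone, whose linear form differs from \<open>\<psi>\<^sub>i\<close> by a positive multiple of the coordinate
  vanishing on that facet.  Minimality thus makes all coordinates of \<open>x\<close> nonnegative, so \<open>x\<close> lies in \<open>C\<^sub>i\<close>,
  where subtracting generators leaves only the listed elements.
\<close>

text \<open>
  Coordinates with respect to the basis \<open>-1, \<rho>, \<kappa>\<close>; then \<open>\<psi>\<^sub>1 = a u - (a v - w)\<close> and
  \<open>\<psi>\<^sub>2 = a (u - (a - 1) (a v - w))\<close>.
\<close>

definition el :: "int \<Rightarrow> 'a::field_char_0 \<Rightarrow> int \<Rightarrow> int \<Rightarrow> int \<Rightarrow> 'a" where
  "el b x v u w = - of_int v + of_int u * x + of_int w * (of_int b * x - x\<^sup>2)"

section \<open>Polynomial evaluation and the sets \<open>Z_adjoin\<close> and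
  \<open>Q_adjoin\<close>\<close>

abbreviation evr :: "'a::field_char_0 \<Rightarrow> rat poly \<Rightarrow> 'a" where
  "evr x p \<equiv> poly (map_poly of_rat p) x"

abbreviation evi :: "'a::field_char_0 \<Rightarrow> int poly \<Rightarrow> 'a" where
  "evi x p \<equiv> poly (map_poly of_int p) x"

lemma evr_pCons [simp]: "evr x (pCons c p) = of_rat c + x * evr x p"
  by (simp add: map_poly_pCons)

lemma evi_pCons [simp]: "evi x (pCons c p) = of_int c + x * evi x p"
  by (simp add: map_poly_pCons)

lemma evr_add [simp]: "evr x (p + q) = evr x p + evr x q"
  by (induction p q rule: poly_induct2) (simp_all add: of_rat_add algebra_simps)

lemma evr_smult [simp]: "evr x (smult c p) = of_rat c * evr x p"
  by (induction p) (simp_all add: of_rat_mult algebra_simps)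

lemma evr_mult [simp]: "evr x (p * q) = evr x p * evr x q"
  by (induction p) (simp_all add: algebra_simps)

lemma evr_diff [simp]: "evr x (p - q) = evr x p - evr x q"
  using evr_add[of "p - q" q x] by (simp del: evr_add)

lemma evi_add [simp]: "evi x (p + q) = evi x p + evi x q"
  by (induction p q rule: poly_induct2) (simp_all add: algebra_simps)

lemma evi_smult [simp]: "evi x (smult c p) = of_int c * evi x p"
  by (induction p) (simp_all add: algebra_simps)

lemma evi_mult [simp]: "evi x (p * q) = evi x p * evi x q"
  by (induction p) (simp_all add: algebra_simps)

lemma evr_of_int_poly: "evr x (map_poly of_int p) = evi x p"
  by (induction p) (simp_all add: map_poly_pCons)

lemma el_eq_evi: "el b x v u w = evi x [:- v, u + b * w, - w:]"
  by (simp add: el_def algebra_simps power2_eq_square)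

lemma evi_cubic: "evi x (cubic a b) = x * (x - of_int a) * (x - of_int b) - 1"
  by (simp add: cubic_def algebra_simps)

lemma Z_adjoin_iff: "x \<in> Z_adjoin \<rho> \<longleftrightarrow> (\<exists>p. x = evi \<rho> p)"
  by (auto simp: Z_adjoin_def)

lemma Z_adjoin_mult: "x \<in> Z_adjoin \<rho> \<Longrightarrow> y \<in> Z_adjoin \<rho> \<Longrightarrow> x * y \<in> Z_adjoin \<rho>"
  unfolding Z_adjoin_iff by (metis evi_mult)

lemma el_in_Z_adjoin: "el b \<rho> v u w \<in> Z_adjoin \<rho>"
  unfolding Z_adjoin_iff el_eq_evi by blast

lemma Q_adjoinE:
  assumes "x \<in> Q_adjoin \<rho>"
  obtains p q where "x = evr \<rho> p / evr \<rho> q" "evr \<rho> q \<noteq> 0"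
  using assms by (auto simp: Q_adjoin_def)

lemma Q_adjoinI: "evr \<rho> q \<noteq> 0 \<Longrightarrow> evr \<rho> p / evr \<rho> q \<in> Q_adjoin \<rho>"
  by (auto simp: Q_adjoin_def)

lemma Q_adjoin_mult:
  assumes "x \<in> Q_adjoin \<rho>" "y \<in> Q_adjoin \<rho>"
  shows "x * y \<in> Q_adjoin \<rho>"
proof -
  obtain p q where x: "x = evr \<rho> p / evr \<rho> q" "evr \<rho> q \<noteq> 0" by (rule Q_adjoinE[OF assms(1)])
  obtain p' q' where y: "y = evr \<rho> p' / evr \<rho> q'" "evr \<rho> q' \<noteq> 0" by (rule Q_adjoinE[OF assms(2)])
  have "x * y = evr \<rho> (p * p') / evr \<rho> (q * q')" by (simp add: x y)
  also have "\<dots> \<in> Q_adjoin \<rho>" using x y by (intro Q_adjoinI) simp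
  finally show ?thesis .
qed

lemma Z_adjoin_subset_Q_adjoin: "x \<in> Z_adjoin \<rho> \<Longrightarrow> x \<in> Q_adjoin \<rho>"
  unfolding Z_adjoin_iff using Q_adjoinI[where q = 1] by (auto simp flip: evr_of_int_poly)

lemma totally_positive_mult:
  "totally_positive (Q_adjoin \<rho>) x \<Longrightarrow> totally_positive (Q_adjoin \<rho>) y \<Longrightarrow>
   totally_positive (Q_adjoin \<rho>) (x * y)"
  by (simp add: totally_positive_def real_embedding_def Q_adjoin_mult)

lemma totally_positive_inverse_factor:
  assumes x: "totally_positive (Q_adjoin \<rho>) x" and y: "y \<in> Q_adjoin \<rho>" and xy: "x * y = 1"
  shows "totally_positive (Q_adjoin \<rho>) y"
  unfolding totally_positive_def
proof safe
  fix \<sigma> assume \<sigma>: "real_embedding (Q_adjoin \<rho>) \<sigma>"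
  then have "\<sigma> x * \<sigma> y = 1" using x y xy
    unfolding real_embedding_def totally_positive_def by metis
  moreover have "0 < \<sigma> x" using x \<sigma> by (simp add: totally_positive_def)
  ultimately show "0 < \<sigma> y" by (metis zero_less_mult_pos zero_less_one)
qed (rule y)

section \<open>Real embeddings and irreducibility of the cubic\<close>

text \<open>An embedding fixes the integers and respects each Horner step. Since it is constrained
  only on \<open>Q_adjoin \<rho>\<close>, every intermediate value must first be shown to lie
  there.\<close>

lemma real_embedding_of_int_poly:
  fixes \<rho> :: "'a::field_char_0"
  assumes "real_embedding (Q_adjoin \<rho>) \<sigma>"
  shows "\<sigma> (evi \<rho> p) = evi (\<sigma> \<rho>) p"
proof -
  have Q: "evi \<rho> p \<in> Q_adjoin \<rho>" for p
    by (rule Z_adjoin_subset_Q_adjoin) (auto simp: Z_adjoin_iff)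
  have \<rho>: "\<rho> \<in> Q_adjoin \<rho>" using Q[of "[:0, 1:]"] by simp
  have int: "of_int n \<in> Q_adjoin \<rho>" for n using Q[of "[:n:]"] by simp
  have add: "\<sigma> (x + y) = \<sigma> x + \<sigma> y" and mult: "\<sigma> (x * y) = \<sigma> x * \<sigma> y"
    if "x \<in> Q_adjoin \<rho>" "y \<in> Q_adjoin \<rho>" for x y
    using assms that by (auto simp: real_embedding_def)
  have \<sigma>1: "\<sigma> 1 = 1" using assms by (simp add: real_embedding_def)
  have \<sigma>0: "\<sigma> 0 = 0" using add[of 0 0] int[of 0] by simp
  have \<sigma>int: "\<sigma> (of_int n) = of_int n" for n
  proof (induction n rule: int_induct[where k = 0])
    case base then show ?case by (simp add: \<sigma>0)
  next
    case (step1 i) then show ?case using add[of "of_int i" 1] int[of i] int[of 1] \<sigma>1 by simp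
  next
    case (step2 i) then show ?case using add[of "of_int (i - 1)" 1] int[of "i - 1"] int[of 1] \<sigma>1 by simp
  qed
  have evi_mult_Q: "\<rho> * evi \<rho> p \<in> Q_adjoin \<rho>" for p using Q[of "pCons 0 p"] by simp
  show ?thesis
    by (induction p) (simp_all add: \<sigma>0 \<sigma>int add mult int \<rho> Q evi_mult_Q)
qed

text \<open>Rational root argument: in lowest terms, numerator and denominator of a root divide
  powers of each other, so only 1 and -1 remain.\<close>

lemma no_rational_root:
  fixes a b :: int and x :: rat
  assumes "2 \<le> a" "a \<le> b - 2"
  shows "x * (x - of_int a) * (x - of_int b) \<noteq> 1"
proof
  assume root: "x * (x - of_int a) * (x - of_int b) = 1"
  obtain m n where x: "x = Rat.Fract m n" "0 < n" "coprime m n"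
    by (cases x)
  then have m: "of_int m = x * of_int n" by (simp add: Rat.Fract_of_int_quotient)
  have "of_int m * (of_int m - of_int a * of_int n) * (of_int m - of_int b * of_int n)
        = x * (x - of_int a) * (x - of_int b) * of_int n ^ 3"
    unfolding m by (simp add: algebra_simps power3_eq_cube)
  then have "(of_int (m * (m - a * n) * (m - b * n)) :: rat) = of_int (n ^ 3)"
    using root by simp
  then have eq: "m * (m - a * n) * (m - b * n) = n ^ 3"
    unfolding of_int_eq_iff .
  then have "m dvd n ^ 3" by (metis dvd_mult2 dvd_triv_left)
  then have m1: "m = 1 \<or> m = -1"
    using x(3) coprime_common_divisor[of m "n ^ 3" m] by auto
  have "m ^ 3 = n * (n ^ 2 + a * m ^ 2 + b * m ^ 2 - a * b * m * n)"
    using eq by (simp add: power3_eq_cube power2_eq_square algebra_simps)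
  then have "n dvd m ^ 3" by simp
  then have "n = 1" using x(2,3) coprime_common_divisor[of "m ^ 3" n n] by auto
  with m1 eq have "(1 - a) * (1 - b) = 1 \<or> (1 + a) * (1 + b) = -1"
    by (auto simp: algebra_simps)
  moreover have "1 * 2 \<le> (a - 1) * (b - 1)" using assms by (intro mult_mono) auto
  moreover have "0 \<le> (1 + a) * (1 + b)" using assms by auto
  ultimately show False by (auto simp: algebra_simps)
qed

text \<open>As the cubic has no rational root, it is irreducible over the rationals.\<close>

lemma conjugates_satisfy_same_polys:
  fixes a b :: int and x :: "'a::field_char_0" and y :: "'b::field_char_0"
  assumes ab: "2 \<le> a" "a \<le> b - 2"
    and x: "evi x (cubic a b) = 0" and y: "evi y (cubic a b) = 0"
    and p: "evr x p = 0"
  shows "evr y p = 0"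
proof -
  define F :: "rat poly" where "F = map_poly of_int (cubic a b)"
  have F: "F = [:-1, of_int (a * b), - of_int (a + b), 1:]"
    by (simp add: F_def cubic_def map_poly_pCons)
  have deg: "degree F = 3" by (simp add: F)
  have nolin: "degree q \<noteq> 1" if "q dvd F" for q
  proof
    assume "degree q = 1"
    then obtain c d where q: "q = [:d, c:]" "c \<noteq> 0" by (rule degree1_coeffs)
    then have "poly q (- d / c) = 0" by simp
    then have "poly F (- d / c) = 0" using that by (auto elim!: dvdE)
    moreover have "poly F z = z * (z - of_int a) * (z - of_int b) - 1" for z
      by (simp add: F algebra_simps)
    ultimately show False using no_rational_root[OF ab, of "- d / c"] by (metis eq_iff_diff_eq_0)
  qed
  \<comment> \<open>By Bezout \<open>g\<close> vanishes at \<open>x\<close>, so it is not constant.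
    As \<open>F\<close> has no linear factor, the cofactor \<open>h\<close> must be constant, and
    \<open>g\<close> inherits the root \<open>y\<close> of \<open>F\<close>.\<close>
  define g where "g = gcd p F"
  have "evr x F = 0" using x by (simp add: F_def evr_of_int_poly)
  then have gx: "evr x g = 0"
    using p unfolding g_def bezout_coefficients_fst_snd[of p F, symmetric] by simp
  obtain h where h: "F = g * h" by (metis g_def gcd_dvd2 dvd_def)
  have nz: "g \<noteq> 0" "h \<noteq> 0" using deg h by auto
  have dgh: "degree g + degree h = 3" using deg h nz by (simp add: degree_mult_eq)
  have "degree g \<noteq> 0"
  proof
    assume "degree g = 0"
    then obtain c where "g = [:c:]" using degree0_coeffs by blast
    then show False using gx nz by simp
  qed
  moreover have "degree g \<noteq> 1" "degree h \<noteq> 1" using nolin h by auto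
  ultimately have "degree h = 0" using dgh by linarith
  then obtain c where c: "h = [:c:]" using degree0_coeffs by blast
  have "evr y g * evr y h = 0"
    using y evr_of_int_poly[where x = y and p = "cubic a b"] h by (simp add: F_def)
  then have "evr y g = 0" using c nz by simp
  then show ?thesis by (metis g_def gcd_dvd1 dvd_def evr_mult mult_zero_left)
qed

text \<open>The embedding sends a quotient of values at \<rho> to the same quotient of values at
  \<open>r\<close>. Cross-multiplying two representations gives a rational polynomial vanishing at
  \<rho>, hence at \<open>r\<close>, so the choice by \<open>SOME\<close> is forced on
  \<open>Q_adjoin \<rho>\<close>.\<close>

lemma real_embedding_exists:
  fixes a b :: int and \<rho> :: "'a::field_char_0" and r :: real
  assumes ab: "2 \<le> a" "a \<le> b - 2"
    and \<rho>: "evi \<rho> (cubic a b) = 0" and r: "evi r (cubic a b) = 0"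
  obtains \<sigma> where "real_embedding (Q_adjoin \<rho>) \<sigma>" "\<sigma> \<rho> = r"
proof -
  define \<sigma> where "\<sigma> x = (SOME y. \<exists>p q. evr \<rho> q \<noteq> 0 \<and> x = evr \<rho> p / evr \<rho> q \<and> y = evr r p / evr r q)" for x
  have nz: "evr r q \<noteq> 0" if "evr \<rho> q \<noteq> 0" for q
    using conjugates_satisfy_same_polys[OF ab r \<rho>] that by blast
  have \<sigma>: "\<sigma> (evr \<rho> p / evr \<rho> q) = evr r p / evr r q" if q: "evr \<rho> q \<noteq> 0" for p q
    unfolding \<sigma>_def
  proof (rule some_equality)
    fix y
    assume "\<exists>p' q'. evr \<rho> q' \<noteq> 0 \<and> evr \<rho> p / evr \<rho> q = evr \<rho> p' / evr \<rho> q' \<and> y = evr r p' / evr r q'"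
    then obtain p' q' where q': "evr \<rho> q' \<noteq> 0" and eq: "evr \<rho> p / evr \<rho> q = evr \<rho> p' / evr \<rho> q'"
      and y: "y = evr r p' / evr r q'" by blast
    have "evr \<rho> (p * q' - p' * q) = 0"
      using eq q q' by (simp add: field_simps)
    then have "evr r (p * q' - p' * q) = 0"
      by (rule conjugates_satisfy_same_polys[OF ab \<rho> r])
    then show "y = evr r p / evr r q"
      unfolding y using nz[OF q] nz[OF q'] by (simp add: frac_eq_eq)
  qed (use q in blast)
  show ?thesis
  proof
    show "real_embedding (Q_adjoin \<rho>) \<sigma>"
      unfolding real_embedding_def
    proof (intro conjI ballI)
      show "\<sigma> 1 = 1" using \<sigma>[of 1 1] by simp
      fix x y assume "x \<in> Q_adjoin \<rho>" "y \<in> Q_adjoin \<rho>"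
      then obtain p q p' q' where x: "x = evr \<rho> p / evr \<rho> q" "evr \<rho> q \<noteq> 0"
        and y: "y = evr \<rho> p' / evr \<rho> q'" "evr \<rho> q' \<noteq> 0"
        by (metis Q_adjoinE)
      have eq: "x * y = evr \<rho> (p * p') / evr \<rho> (q * q')"
        "x + y = evr \<rho> (p * q' + p' * q) / evr \<rho> (q * q')"
        unfolding x(1) y(1) using x(2) y(2) by (simp_all add: add_frac_eq)
      have "evr \<rho> (q * q') \<noteq> 0" using x y by simp
      note \<sigma>qq = \<sigma>[OF this]
      have \<sigma>xy: "\<sigma> x = evr r p / evr r q" "\<sigma> y = evr r p' / evr r q'"
        unfolding x(1) y(1) using \<sigma> x(2) y(2) by blast+
      show "\<sigma> (x + y) = \<sigma> x + \<sigma> y" unfolding eq \<sigma>qq \<sigma>xy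
        using nz[OF x(2)] nz[OF y(2)] by (simp add: add_frac_eq)
      show "\<sigma> (x * y) = \<sigma> x * \<sigma> y" unfolding eq \<sigma>qq \<sigma>xy by simp
    qed
    show "\<sigma> \<rho> = r" using \<sigma>[of 1 "[:0, 1:]"] by simp
  qed
qed

text \<open>Embeddings correspond to real roots of the cubic: each maps \<rho> to such a root, and
  each root arises this way.\<close>

lemma totally_positive_el_iff:
  fixes a b :: int and \<rho> :: "'a::field_char_0"
  assumes ab: "2 \<le> a" "a \<le> b - 2" and \<rho>: "evi \<rho> (cubic a b) = 0"
  shows "totally_positive (Q_adjoin \<rho>) (el b \<rho> v u w) \<longleftrightarrow>
         (\<forall>r::real. r * (r - of_int a) * (r - of_int b) = 1 \<longrightarrow> 0 < el b r v u w)"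
proof (intro iffI allI impI)
  fix r :: real
  assume tp: "totally_positive (Q_adjoin \<rho>) (el b \<rho> v u w)"
    and r: "r * (r - of_int a) * (r - of_int b) = 1"
  have "evi r (cubic a b) = 0" using r by (simp add: evi_cubic)
  with real_embedding_exists[OF ab \<rho>] obtain \<sigma>
    where \<sigma>: "real_embedding (Q_adjoin \<rho>) \<sigma>" "\<sigma> \<rho> = r" by blast
  have "0 < \<sigma> (el b \<rho> v u w)" using tp \<sigma> by (simp add: totally_positive_def)
  then show "0 < el b r v u w"
    unfolding el_eq_evi using real_embedding_of_int_poly[OF \<sigma>(1)] \<sigma>(2) by metis
next
  assume pos: "\<forall>r::real. r * (r - of_int a) * (r - of_int b) = 1 \<longrightarrow> 0 < el b r v u w"
  show "totally_positive (Q_adjoin \<rho>) (el b \<rho> v u w)"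
    unfolding totally_positive_def
  proof (intro conjI allI impI)
    fix \<sigma> assume \<sigma>: "real_embedding (Q_adjoin \<rho>) \<sigma>"
    note ev = real_embedding_of_int_poly[OF \<sigma>]
    have "evi (\<sigma> \<rho>) (cubic a b) = 0" using ev[of "cubic a b"] ev[of 0] \<rho> by simp
    then show "0 < \<sigma> (el b \<rho> v u w)"
      using pos ev unfolding el_eq_evi evi_cubic by (metis eq_iff_diff_eq_0)
  qed (intro Z_adjoin_subset_Q_adjoin el_in_Z_adjoin)
qed

section \<open>Location of the real roots and bounds for the two linear forms\<close>

text \<open>Intermediate values of \<open>x * (x - a) * (x - b)\<close>, which is 0 at 0,
  \<open>a\<close> and \<open>b\<close>, and at least 1 at \<open>q\<close>, 1 and
  \<open>b + 1\<close>.\<close>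

lemma real_roots:
  fixes a b :: real
  assumes "2 \<le> a" "a + 2 \<le> b"
  obtains r s t :: real where
    "r * (r - a) * (r - b) = 1" "0 < r" "r < 1" "r * (a - 1) * (b + 1) \<le> 1"
    "s * (s - a) * (s - b) = 1" "1 \<le> s" "s \<le> a"
    "t * (t - a) * (t - b) = 1" "b \<le> t" "t \<le> b + 1"
proof -
  let ?g = "\<lambda>x::real. x * (x - a) * (x - b)"
  let ?h = "\<lambda>x::real. - (x * (x - a) * (x - b))"
  have cont: "continuous_on S ?g" "continuous_on S ?h" for S
    by (intro continuous_intros)+
  \<comment> \<open>Chosen so that \<open>r \<le> 1 / P\<close> and \<open>t \<le> b + 1\<close>
    together give \<open>(a - 1) * r * t \<le> 1\<close>.\<close>
  define P where "P = (a - 1) * (b + 1)"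
  define q where "q = 1 / P"
  have "1 * (b + 1) \<le> (a - 1) * (b + 1)"
    using assms by (intro mult_right_mono) auto
  then have P: "b + 1 \<le> P" by (simp add: P_def)
  then have q: "0 < q" "q < 1" "q * P = 1"
    using assms by (auto simp: q_def)
  have "q * (a + b) \<le> q * (3 * P)"
    using P assms q by (intro mult_left_mono) auto
  then have "q * (a + b) \<le> 3" using q by (simp add: algebra_simps)
  moreover have "(q - a) * (q - b) - P = q * q + (3 - q * (a + b)) + (b - a - 2)"
    by (simp add: P_def algebra_simps)
  ultimately have "P \<le> (q - a) * (q - b)"
    using assms zero_le_square[of q] by linarith
  then have "q * P \<le> q * ((q - a) * (q - b))"
    using q by (intro mult_left_mono) auto
  then have "1 \<le> ?g q" using q by (simp add: algebra_simps)
  then obtain r where r: "0 \<le> r" "r \<le> q" "?g r = 1"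
    using IVT'[OF _ _ _ cont(1), of 0 1 q] q by auto
  have "r * P \<le> 1" using mult_right_mono[of r q P] r q P assms by auto
  have "1 * 2 \<le> (a - 1) * (b - 1)" using assms by (intro mult_mono) auto
  then have "- ?g 1 \<le> -1" by (simp add: algebra_simps)
  then obtain s where s: "1 \<le> s" "s \<le> a" "?g s = 1"
    using IVT'[OF _ _ _ cont(2), of 1 "-1" a] assms by auto
  have "1 * 1 \<le> (b + 1) * (b + 1 - a)" using assms by (intro mult_mono) auto
  then obtain t where t: "b \<le> t" "t \<le> b + 1" "?g t = 1"
    using IVT'[OF _ _ _ cont(1), of b 1 "b + 1"] by auto
  show ?thesis
  proof (rule that)
    show "0 < r" using r by (cases "r = 0") auto
    show "r < 1" using r q by simp
    show "r * (a - 1) * (b + 1) \<le> 1" using \<open>r * P \<le> 1\<close> by (simp add: P_def mult.assoc)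
  qed (use r s t in auto)
qed

text \<open>These are the bounds for \<open>\<psi>\<^sub>1\<close> and for
  \<open>\<psi>\<^sub>2\<close> divided by \<open>a\<close>. If \<open>e > 0\<close>, the smallest
  and largest roots suffice; the middle root is used only when \<open>e\<close> and \<open>u\<close>
  are both nonpositive.\<close>

lemma functional_bounds:
  fixes a b u v w :: int
  assumes ab: "2 \<le> a" "a \<le> b - 2"
    and pos: "\<And>x::real. x * (x - of_int a) * (x - of_int b) = 1 \<Longrightarrow> 0 < el b x v u w"
  shows "a \<le> a * u - (a * v - w)" "0 < u - (a - 1) * (a * v - w)"
proof -
  define e where "e = a * v - w"
  let ?a = "real_of_int a" and ?b = "real_of_int b" and ?u = "real_of_int u"
    and ?v = "real_of_int v" and ?w = "real_of_int w" and ?e = "real_of_int e"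
  have ab': "2 \<le> ?a" "?a + 2 \<le> ?b" using ab by linarith+
  have w: "?w = ?a * ?v - ?e" by (simp add: e_def)
  obtain r s t where
    r: "r * (r - ?a) * (r - ?b) = 1" "0 < r" "r < 1" "r * (?a - 1) * (?b + 1) \<le> 1" and
    s: "s * (s - ?a) * (s - ?b) = 1" "1 \<le> s" "s \<le> ?a" and
    t: "t * (t - ?a) * (t - ?b) = 1" "?b \<le> t" "t \<le> ?b + 1"
    using real_roots[OF ab'] by blast
  \<comment> \<open>Multiplying by \<open>t - ?a\<close> lets the cubic equation replace the factor
    at \<open>?w\<close> by a constant.\<close>
  have T: "0 < t * ((t - ?a) * ?u - ?v) + ?e"
  proof -
    have "0 < (t - ?a) * el b t v u w" using t ab' pos by (intro mult_pos_pos) auto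
    also have "\<dots> = (t - ?a) * (?u * t - ?v) - ?w * (t * (t - ?a) * (t - ?b))"
      by (simp add: el_def algebra_simps power2_eq_square)
    finally show ?thesis unfolding t(1) w by (simp add: algebra_simps)
  qed
  show "a \<le> a * u - (a * v - w) " "0 < u - (a - 1) * (a * v - w)"
    unfolding e_def[symmetric]
  proof -
    have pos_case: "0 < u \<and> (a - 1) * e < u" if "0 < e"
    proof -
      have R: "0 < r * (?v + ?u * (?a - r)) - ?e"
      proof -
        have "0 < (?a - r) * el b r v u w" using r ab' pos by (intro mult_pos_pos) auto
        also have "\<dots> = (?a - r) * (?u * r - ?v) + ?w * (r * (r - ?a) * (r - ?b))"
          by (simp add: el_def algebra_simps power2_eq_square)
        finally show ?thesis unfolding r(1) w by (simp add: algebra_simps)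
      qed
      \<comment> \<open>The weights \<open>r\<close> and \<open>t\<close> eliminate
        \<open>?v\<close>.\<close>
      have "0 < r * (t * ((t - ?a) * ?u - ?v) + ?e) + t * (r * (?v + ?u * (?a - r)) - ?e)"
        using mult_pos_pos[OF _ T] mult_pos_pos[OF _ R] r t ab' by (intro add_pos_pos) auto
      also have "\<dots> = (t - r) * (r * t * ?u - ?e)" by (simp add: algebra_simps)
      finally have ltu: "?e < r * t * ?u"
        using r t ab' by (auto simp: zero_less_mult_iff)
      then have "0 < (r * t) * ?u" using that by linarith
      moreover have rt: "0 < r * t" using r t ab' by auto
      ultimately have u: "0 < ?u" using zero_less_mult_pos by blast
      have "r * (?a - 1) * t \<le> r * (?a - 1) * (?b + 1)"
        using r t ab' by (intro mult_left_mono) auto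
      also have "\<dots> \<le> 1" by (rule r)
      finally have "r * (?a - 1) * t * ?u \<le> 1 * ?u" using u by (intro mult_right_mono) auto
      moreover have "(?a - 1) * ?e < (?a - 1) * (r * t * ?u)" using ltu ab' by auto
      ultimately have "(?a - 1) * ?e < ?u" by (simp add: algebra_simps)
      moreover have "(?a - 1) * ?e = of_int ((a - 1) * e)" by simp
      ultimately show ?thesis using u by linarith
    qed
    show A: "a \<le> a * u - e"
    proof (cases "0 < e")
      case True
      then have "(a - 1) * e + 1 \<le> u" using pos_case by auto
      then have "a * ((a - 1) * e + 1) \<le> a * u" using ab by (intro mult_left_mono) auto
      moreover have "1 * e \<le> (a * (a - 1)) * e"
        using True ab mult_mono[of 1 a 1 "a - 1"] by (intro mult_right_mono) auto
      ultimately show ?thesis by (simp add: algebra_simps)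
    next
      case False
      show ?thesis
      proof (cases "0 < u")
        case True
        then have "a * 1 \<le> a * u" using ab by (intro mult_left_mono) auto
        then show ?thesis using False by simp
      next
        case u: False
        have "0 < t * ((t - ?a) * ?u - ?v)" using T False by linarith
        then have "0 < (t - ?a) * ?u - ?v" using t ab' by (auto simp: zero_less_mult_iff)
        \<comment> \<open>Here \<open>t - ?a\<close> is at least 2 and \<open>?u\<close> is
          nonpositive, so \<open>v\<close> is forced below \<open>2 * u\<close>.\<close>
        moreover have "(t - ?a) * ?u \<le> 2 * ?u"
          using t ab' u by (intro mult_right_mono_neg) auto
        ultimately have v: "v + 1 \<le> 2 * u" by linarith
        then have v1: "v \<le> -1" using u by auto
        \<comment> \<open>The conjugate of \<kappa> at the middle root. As \<open>k \<ge> 1\<close>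
          and \<open>v < 0\<close>, positivity at \<open>s\<close> forces
          \<open>w > v\<close>.\<close>
        define k where "k = s * (?b - s)"
        have k: "1 \<le> k" unfolding k_def using mult_mono[of 1 s 1 "?b - s"] s ab' by auto
        have "0 < el b s v u w" using pos s by auto
        also have "\<dots> = - ?v + ?u * s + k * ?w"
          by (simp add: el_def k_def algebra_simps power2_eq_square)
        also have "\<dots> \<le> - ?v + k * ?w" using u s by (simp add: mult_nonpos_nonneg)
        also have "\<dots> \<le> k * (?w - ?v)" using mult_right_mono_neg[OF k, of ?v] v1
          by (simp add: algebra_simps)
        finally have "0 < ?w - ?v" using k by (simp add: zero_less_mult_iff)
        then have "v + 1 \<le> a * v - e" unfolding e_def by linarith
        then have "2 * (a * u - e) \<ge> a * (2 * u) - 2 * a * v + 2 * v + 2" by (simp add: algebra_simps)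
        moreover have "a * (v + 1) \<le> a * (2 * u)" using v ab by (intro mult_left_mono) auto
        moreover have "(a - 2) * v \<le> (a - 2) * (-1)" using v1 ab by (intro mult_left_mono) auto
        ultimately have "2 * a \<le> 2 * (a * u - e)" by (simp add: algebra_simps)
        then show ?thesis by simp
      qed
    qed
    show "0 < u - (a - 1) * e"
    proof (cases "0 < e")
      case True then show ?thesis using pos_case by auto
    next
      case False
      \<comment> \<open>For \<open>e \<le> 0\<close> this says
        \<open>\<psi>\<^sub>2 \<ge> \<psi>\<^sub>1\<close>, so the bound \<open>A\<close> already
        gives positivity.\<close>
      have "a * ((a - 1) * e) \<le> 1 * e"
        using False ab mult_mono[of 1 a 1 "a - 1"] mult_right_mono_neg[of 1 "a * (a - 1)" e]
        by (auto simp: algebra_simps)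
      then have "0 < a * (u - (a - 1) * e)" using A ab by (simp add: algebra_simps)
      then show ?thesis using ab by (simp add: zero_less_mult_iff)
    qed
  qed
qed


section \<open>Conic combinations and totally positive units\<close>

lemma conic_combination_pos:
  fixes X Y Z :: int and x y z :: real
  assumes "0 \<le> X" "0 \<le> Y" "0 \<le> Z" "X \<noteq> 0 \<or> Y \<noteq> 0 \<or> Z \<noteq> 0"
    and "0 < x" "0 < y" "0 < z"
  shows "0 < of_int X * x + of_int Y * y + of_int Z * z"
proof -
  have "0 \<le> of_int X * x" "0 \<le> of_int Y * y" "0 \<le> of_int Z * z"
    using assms by auto
  moreover have "of_int X * x \<noteq> 0 \<or> of_int Y * y \<noteq> 0 \<or> of_int Z * z \<noteq> 0"
    using assms by auto
  ultimately show ?thesis by linarith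
qed

lemma totally_positive_unit_mult:
  assumes "totally_positive_unit \<rho> x" "totally_positive_unit \<rho> y"
  shows "totally_positive_unit \<rho> (x * y)"
proof -
  obtain x' y' where "x' \<in> Z_adjoin \<rho>" "x * x' = 1" "y' \<in> Z_adjoin \<rho>" "y * y' = 1"
    using assms by (auto simp: totally_positive_unit_def)
  then have "x' * y' \<in> Z_adjoin \<rho>" "(x * y) * (x' * y') = 1"
    by (auto simp: Z_adjoin_mult mult.assoc mult.left_commute[of y])
  then show ?thesis
    using assms by (auto simp: totally_positive_unit_def Z_adjoin_mult totally_positive_mult)
qed

lemma totally_positive_unit_inverse:
  assumes "totally_positive_unit \<rho> x" "y \<in> Z_adjoin \<rho>" "x * y = 1"
  shows "totally_positive_unit \<rho> y"
  using assms totally_positive_inverse_factor[of \<rho> x y] Z_adjoin_subset_Q_adjoin[of y \<rho>]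
  unfolding totally_positive_unit_def by (metis mult.commute)

lemma totally_positive_unitE:
  assumes "totally_positive_unit \<rho> x"
  obtains y where "totally_positive_unit \<rho> y" "x * y = 1"
  using assms totally_positive_unit_inverse unfolding totally_positive_unit_def by metis

text \<open>The inverse unit turns a decomposition of \<open>\<epsilon> * \<alpha>\<close> into one
  of \<alpha>.\<close>

lemma indecomposable_unit_mult:
  assumes \<epsilon>: "totally_positive_unit \<rho> \<epsilon>" and \<alpha>: "indecomposable \<rho> \<alpha>"
  shows "indecomposable \<rho> (\<epsilon> * \<alpha>)"
proof -
  obtain \<eta> where \<eta>: "totally_positive_unit \<rho> \<eta>" "\<epsilon> * \<eta> = 1"
    using \<epsilon> by (rule totally_positive_unitE)
  have "\<alpha> = \<eta> * \<beta> + \<eta> * \<gamma>" if "\<epsilon> * \<alpha> = \<beta> + \<gamma>" for \<beta> \<gamma>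
  proof -
    have "\<alpha> = \<eta> * (\<epsilon> * \<alpha>)" using \<eta>(2) by (metis mult.assoc mult.commute mult_1_right)
    then show ?thesis by (simp add: that distrib_left)
  qed
  then show ?thesis
    using \<epsilon> \<eta> \<alpha> unfolding indecomposable_def totally_positive_unit_def
    by (metis Z_adjoin_mult totally_positive_mult)
qed

section \<open>Coordinates and the action of the units on them\<close>

locale cubic_root =
  fixes a b :: int and \<rho> :: "'a::field_char_0"
  assumes ab: "2 \<le> a" "a \<le> b - 2" and root: "evi \<rho> (cubic a b) = 0"
begin

abbreviation E :: "int \<Rightarrow> int \<Rightarrow> int \<Rightarrow> 'a" where
  "E \<equiv> el b \<rho>"

abbreviation TP :: "'a \<Rightarrow> bool" where
  "TP \<equiv> totally_positive (Q_adjoin \<rho>)"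

definition rho_inv :: 'a where "rho_inv = (\<rho> - of_int a) * (\<rho> - of_int b)"
definition kappa :: 'a where "kappa = of_int b * \<rho> - \<rho>\<^sup>2"
definition kappa_inv :: 'a where "kappa_inv = of_int a - \<rho>"

lemma rho_rho_inv: "\<rho> * rho_inv = 1"
  using root by (simp add: evi_cubic rho_inv_def mult.assoc)

lemma kappa_kappa_inv: "kappa * kappa_inv = 1"
  using rho_rho_inv by (simp add: rho_inv_def kappa_def kappa_inv_def algebra_simps power2_eq_square)

text \<open>This and the next three rules describe how units act on coordinates; they yield the
  linear forms of the translated cones.\<close>

lemma rho_mult: "\<rho> * E v u w = E w (b * u - v) (a * w - u)"
  using rho_rho_inv by (simp add: el_def rho_inv_def) algebra

lemma rho_inv_mult: "rho_inv * E v u w = E (b * (a * v - w) - u) (a * v - w) v"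
  using rho_rho_inv by (simp add: el_def rho_inv_def) algebra

lemma kappa_mult:
  "kappa * E v u w = E (u + (b - a) * w) w (- v + a * u + a * (b - a) * w)"
  using rho_rho_inv by (simp add: el_def rho_inv_def kappa_def) algebra

lemma kappa_inv_mult: "kappa_inv * E v u w = E (a * v - w) (v - (b - a) * u) u"
  using rho_rho_inv by (simp add: el_def rho_inv_def kappa_inv_def) algebra

lemma E_one: "E (-1) 0 0 = 1" and E_rho: "E 0 1 0 = \<rho>" and E_kappa: "E 0 0 1 = kappa"
  by (simp_all add: el_def kappa_def)

lemma E_kappa_sq: "E (b - a) 1 (a * (b - a)) = kappa\<^sup>2"
  using kappa_mult[of 0 0 1] by (simp add: E_kappa power2_eq_square)

lemma E_rho_kappa_sq: "E (a * (b - a)) a (a * a * (b - a) - 1) = \<rho> * kappa\<^sup>2"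
  unfolding E_kappa_sq[symmetric] rho_mult by (simp add: algebra_simps)

lemma E_diff: "E v u w - E v' u' w' = E (v - v') (u - u') (w - w')"
  by (simp add: el_def algebra_simps)

text \<open>The elements \<open>E v u w\<close> include 0 and are stable under multiplication by
  \<rho> and addition of integers, so Horner evaluation never leaves them.\<close>

lemma Z_adjoinE:
  assumes "x \<in> Z_adjoin \<rho>"
  obtains v u w where "x = E v u w"
proof -
  obtain p where p: "x = evi \<rho> p" using assms Z_adjoin_iff by blast
  have "\<exists>v u w. evi \<rho> p = E v u w"
  proof (induction p)
    case 0
    show ?case by (rule exI[of _ 0])+ (simp add: el_def)
  next
    case (pCons c p)
    then obtain v u w where "evi \<rho> p = E v u w" by blast
    then have "evi \<rho> (pCons c p) = E (w - c) (b * u - v) (a * w - u)"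
      using rho_mult[of v u w] by (simp add: el_def)
    then show ?case by blast
  qed
  with p that show ?thesis by blast
qed

section \<open>Total positivity in coordinates and on the two cones\<close>

lemma TP_E_iff:
  "TP (E v u w) \<longleftrightarrow> (\<forall>r::real. r * (r - of_int a) * (r - of_int b) = 1 \<longrightarrow> 0 < el b r v u w)"
  by (rule totally_positive_el_iff[OF ab root])

lemma TP_bounds:
  assumes "TP (E v u w)"
  shows "a \<le> a * u - (a * v - w)" "0 < u - (a - 1) * (a * v - w)"
  using functional_bounds[OF ab, of v u w] assms unfolding TP_E_iff by blast+

lemma real_conjugate_pos:
  fixes r :: real
  assumes "r * (r - of_int a) * (r - of_int b) = 1"
  shows "0 < r"
proof (rule ccontr)
  assume "\<not> 0 < r"
  then have "r * ((r - of_int a) * (r - of_int b)) \<le> 0"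
    using ab by (intro mult_nonpos_nonneg mult_nonpos_nonpos) auto
  then show False using assms by (simp add: mult.assoc)
qed

text \<open>
  The coefficients of \<open>1, \<rho>, \<kappa>\<^sup>2\<close> in \<open>E v u w\<close>, scaled by \<open>a (b - a)\<close>, are
  \<open>(b - a) (w - a v)\<close>, \<open>a (b - a) u - w\<close> and \<open>w\<close>.
\<close>

lemma TP_cone1:
  assumes "0 \<le> w" "a * v \<le> w" "w \<le> a * (b - a) * u" "(v, u, w) \<noteq> (0, 0, 0)"
  shows "TP (E v u w)"
  unfolding TP_E_iff
proof (intro allI impI)
  fix r :: real
  assume r: "r * (r - of_int a) * (r - of_int b) = 1"
  define k where "k = of_int b * r - r\<^sup>2"
  have "r \<noteq> 0" "r \<noteq> of_int b" using r by auto
  then have "k \<noteq> 0" by (simp add: k_def power2_eq_square flip: left_diff_distrib)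
  then have k: "0 < k\<^sup>2" by simp
  let ?d = "b - a"
  have eq: "of_int (a * ?d) * el b r v u w
      = of_int (?d * (w - a * v)) * 1 + of_int (a * ?d * u - w) * r + of_int w * k\<^sup>2"
    using r by (simp add: k_def el_def) algebra
  have "0 < of_int (a * ?d) * el b r v u w"
    unfolding eq using assms ab real_conjugate_pos[OF r] k
    by (intro conic_combination_pos) auto
  moreover have "(0::real) < of_int (a * ?d)" using ab by auto
  ultimately show "0 < el b r v u w" using zero_less_mult_pos by blast
qed

text \<open>
  The coefficients of \<open>\<rho>\<kappa>\<^sup>2, \<rho>, \<kappa>\<^sup>2\<close> in \<open>E v u w\<close>, scaled by \<open>b - a\<close>, are
  \<open>(b - a) e\<close>, \<open>(b - a) u - v\<close> and \<open>v - a (b - a) e\<close> with \<open>e = a v - w\<close>.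
\<close>

lemma TP_cone2:
  assumes "0 \<le> a * v - w" "a * (b - a) * (a * v - w) \<le> v" "v \<le> (b - a) * u" "(v, u, w) \<noteq> (0, 0, 0)"
  shows "TP (E v u w)"
  unfolding TP_E_iff
proof (intro allI impI)
  fix r :: real
  assume r: "r * (r - of_int a) * (r - of_int b) = 1"
  define k where "k = of_int b * r - r\<^sup>2"
  have "r \<noteq> 0" "r \<noteq> of_int b" using r by auto
  then have "k \<noteq> 0" by (simp add: k_def power2_eq_square flip: left_diff_distrib)
  then have k: "0 < k\<^sup>2" by simp
  let ?d = "b - a" and ?e = "a * v - w"
  have eq: "of_int ?d * el b r v u w
      = of_int (?d * ?e) * (r * k\<^sup>2) + of_int (?d * u - v) * r + of_int (v - a * ?d * ?e) * k\<^sup>2"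
    using r by (simp add: k_def el_def) algebra
  have "0 < of_int ?d * el b r v u w"
    unfolding eq using assms ab real_conjugate_pos[OF r] k
    by (intro conic_combination_pos) auto
  moreover have "(0::real) < of_int ?d" using ab by auto
  ultimately show "0 < el b r v u w" using zero_less_mult_pos by blast
qed

section \<open>The totally positive units generated by \<rho> and
  \<open>\<kappa>\<^sup>2\<close>\<close>

lemma Z_adjoin_gens: "\<rho> \<in> Z_adjoin \<rho>" "rho_inv \<in> Z_adjoin \<rho>" "kappa\<^sup>2 \<in> Z_adjoin \<rho>" "kappa_inv\<^sup>2 \<in> Z_adjoin \<rho>"
  using el_in_Z_adjoin rho_inv_mult[of "-1" 0 0] kappa_inv_mult[of "-1" 0 0]
  by (metis E_rho E_one E_kappa_sq mult_1_right Z_adjoin_mult power2_eq_square)+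

lemma unit_rho: "totally_positive_unit \<rho> \<rho>"
  using Z_adjoin_gens rho_rho_inv TP_cone1[of 0 0 1] ab
  unfolding E_rho totally_positive_unit_def by auto

lemma unit_rho_inv: "totally_positive_unit \<rho> rho_inv"
  using totally_positive_unit_inverse[OF unit_rho] Z_adjoin_gens rho_rho_inv by blast

lemma kappa_sq_kappa_inv_sq: "kappa\<^sup>2 * kappa_inv\<^sup>2 = 1"
  using kappa_kappa_inv by (metis power_mult_distrib power_one)

text \<open>The square is essential: \<kappa> is inverse to \<open>a - \<rho>\<close>, hence
  negative at the conjugate above \<open>b\<close>.\<close>

lemma unit_kappa_sq: "totally_positive_unit \<rho> (kappa\<^sup>2)"
  using Z_adjoin_gens kappa_sq_kappa_inv_sq TP_cone1[of "a * (b - a)" "b - a" 1] ab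
  unfolding E_kappa_sq totally_positive_unit_def by auto

lemma unit_kappa_inv_sq: "totally_positive_unit \<rho> (kappa_inv\<^sup>2)"
  using totally_positive_unit_inverse[OF unit_kappa_sq] Z_adjoin_gens kappa_sq_kappa_inv_sq by blast

section \<open>Indecomposability of the listed elements\<close>

lemma triangle_elements_altdef:
  "triangle_elements a b \<rho> =
     {E v 1 w | v w. 0 \<le> v \<and> v \<le> b - a - 1 \<and> v * a \<le> w \<and> w \<le> (v + 1) * a - 1}"
  by (simp add: triangle_elements_def el_def algebra_simps)

text \<open>\<open>\<psi>\<^sub>1\<close> is additive and at least \<open>a\<close> on each totally
  positive summand, but on these elements it is
  \<open>a + (w - a * v) \<le> 2 * a - 1\<close>.\<close>

lemma triangle_indecomposable:
  assumes "\<alpha> \<in> triangle_elements a b \<rho>"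
  shows "indecomposable \<rho> \<alpha>"
proof -
  obtain v w where \<alpha>: "\<alpha> = E v 1 w" and v: "0 \<le> v" "v \<le> b - a - 1"
    and w: "v * a \<le> w" "w \<le> (v + 1) * a - 1"
    using assms unfolding triangle_elements_altdef by blast
  have "(v + 1) * a \<le> (b - a) * a" using v ab by (intro mult_right_mono) auto
  moreover have "0 \<le> v * a" using v ab by simp
  ultimately have "TP \<alpha>" unfolding \<alpha> using w
    by (intro TP_cone1) (auto simp: mult.commute)
  moreover have False if dec: "\<beta> \<in> Z_adjoin \<rho>" "TP \<beta>" "TP \<gamma>" "\<alpha> = \<beta> + \<gamma>" for \<beta> \<gamma>
  proof -
    obtain v' u' w' where \<beta>: "\<beta> = E v' u' w'" using dec(1) by (rule Z_adjoinE)
    \<comment> \<open>Choosing these coordinates for \<open>\<gamma>\<close> avoids proving that coordinates are unique.\<close>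
    have "\<gamma> = E (v - v') (1 - u') (w - w')"
      using dec by (simp add: \<alpha> \<beta> flip: E_diff)
    then have "a \<le> a * u' - (a * v' - w')" "a \<le> a * (1 - u') - (a * (v - v') - (w - w'))"
      using dec TP_bounds(1) \<beta> by auto
    then show False using w by (simp add: algebra_simps)
  qed
  ultimately show ?thesis
    unfolding indecomposable_def using el_in_Z_adjoin \<alpha> by blast
qed

section \<open>Reduction of an arbitrary indecomposable to the list\<close>

definition associated_to_triangle :: "'a \<Rightarrow> bool" where
  "associated_to_triangle \<alpha> \<longleftrightarrow>
     (\<exists>\<tau> \<in> triangle_elements a b \<rho>. \<exists>\<epsilon>. totally_positive_unit \<rho> \<epsilon> \<and> \<alpha> = \<epsilon> * \<tau>)"

lemma associated_unit_mult:
  assumes "totally_positive_unit \<rho> \<epsilon>" "associated_to_triangle (\<epsilon> * \<alpha>)"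
  shows "associated_to_triangle \<alpha>"
proof -
  obtain \<eta> where \<eta>: "totally_positive_unit \<rho> \<eta>" "\<epsilon> * \<eta> = 1"
    using assms(1) by (rule totally_positive_unitE)
  obtain \<tau> \<delta> where \<tau>: "\<tau> \<in> triangle_elements a b \<rho>" "totally_positive_unit \<rho> \<delta>" "\<epsilon> * \<alpha> = \<delta> * \<tau>"
    using assms(2) by (auto simp: associated_to_triangle_def)
  have "\<alpha> = \<eta> * (\<epsilon> * \<alpha>)" using \<eta>(2) by (metis mult.assoc mult.commute mult_1_right)
  then have "\<alpha> = (\<eta> * \<delta>) * \<tau>" using \<tau>(3) by (simp add: mult.assoc)
  then show ?thesis
    using \<tau> totally_positive_unit_mult[OF \<eta>(1) \<tau>(2)] by (auto simp: associated_to_triangle_def)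
qed

lemma rho_in_triangle: "\<rho> \<in> triangle_elements a b \<rho>"
  unfolding triangle_elements_altdef using ab E_rho by force

text \<open>A unit is reached from the listed element \<rho>, itself a unit.\<close>

lemma associated_unit:
  assumes "totally_positive_unit \<rho> x"
  shows "associated_to_triangle x"
proof -
  have "x = (x * rho_inv) * \<rho>" using rho_rho_inv by (metis mult.assoc mult.commute mult_1_right)
  then show ?thesis
    using rho_in_triangle totally_positive_unit_mult[OF assms unit_rho_inv]
    unfolding associated_to_triangle_def by blast
qed

lemma indecomposable_not_TP_diff:
  assumes "indecomposable \<rho> (E v u w)" "TP (E v' u' w')"
  shows "\<not> TP (E (v - v') (u - u') (w - w'))"
proof
  assume "TP (E (v - v') (u - u') (w - w'))"
  moreover have "E v u w = E v' u' w' + E (v - v') (u - u') (w - w')"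
    by (simp flip: E_diff)
  ultimately show False
    using assms el_in_Z_adjoin unfolding indecomposable_def by blast
qed

text \<open>If a generator can be subtracted within the cone, the remainder must be 0 and the
  element is a unit. Otherwise all three coefficients are below 1, and the integral points left are
  the listed ones.\<close>

lemma associated_cone1:
  assumes x: "indecomposable \<rho> (E v u w)"
    and cone: "0 \<le> w" "a * v \<le> w" "w \<le> a * (b - a) * u"
  shows "associated_to_triangle (E v u w)"
proof -
  let ?D = "a * (b - a)"
  have D: "0 < ?D" using ab by simp
  have unit1: "totally_positive_unit \<rho> 1"
    using totally_positive_unit_mult[OF unit_rho unit_rho_inv] by (simp add: rho_rho_inv)
  consider "a \<le> w - a * v" | "?D \<le> ?D * u - w" | "?D \<le> w"
    | "w - a * v < a" "?D * u - w < ?D" "w < ?D" by linarith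
  then show ?thesis
  proof cases
    case 1
    have "TP (E (-1) 0 0)" using unit1 by (simp add: E_one totally_positive_unit_def)
    then have "(v + 1, u, w) = (0, 0, 0)"
      using indecomposable_not_TP_diff[OF x] TP_cone1[of w "v + 1" u] cone 1
      by (fastforce simp: algebra_simps)
    then have "v = -1" "u = 0" "w = 0" by auto
    then show ?thesis using associated_unit[OF unit1] E_one by simp
  next
    case 2
    have "TP (E 0 1 0)" using unit_rho by (simp add: E_rho totally_positive_unit_def)
    then have "(v, u - 1, w) = (0, 0, 0)"
      using indecomposable_not_TP_diff[OF x] TP_cone1[of w v "u - 1"] cone 2
      by (fastforce simp: algebra_simps)
    then show ?thesis using associated_unit[OF unit_rho] E_rho by simp
  next
    case 3
    have "TP (E (b - a) 1 ?D)" using unit_kappa_sq by (simp add: E_kappa_sq totally_positive_unit_def)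
    then have "(v - (b - a), u - 1, w - ?D) = (0, 0, 0)"
      using indecomposable_not_TP_diff[OF x] TP_cone1[of "w - ?D" "v - (b - a)" "u - 1"] cone 3
      by (fastforce simp: algebra_simps)
    then show ?thesis using associated_unit[OF unit_kappa_sq] E_kappa_sq by simp
  next
    case 4
    have "?D * u < ?D * 2" "0 \<le> ?D * u" using 4 cone by linarith+
    then have "u < 2" "0 \<le> u"
      using D mult_less_cancel_left_pos[OF D] zero_le_mult_iff[of ?D u] by auto
    \<comment> \<open>At \<open>u = 0\<close> the form \<open>\<psi>\<^sub>1\<close> equals
      \<open>w - a * v\<close>, which is below its lower bound \<open>a\<close>.\<close>
    moreover have "u \<noteq> 0"
    proof
      assume "u = 0"
      moreover have "a \<le> a * u - (a * v - w)"
        using x TP_bounds(1) by (simp add: indecomposable_def)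
      ultimately show False using 4 by simp
    qed
    ultimately have u: "u = 1" by linarith
    \<comment> \<open>The strict bound \<open>w - a * v < a\<close> together with
      \<open>0 \<le> w\<close> gives \<open>v > -1\<close>.\<close>
    have "0 < a * (v + 1)" using 4 cone by (simp add: algebra_simps)
    then have "0 \<le> v" using ab by (simp add: zero_less_mult_iff)
    moreover have "a * v < a * (b - a)" using 4 cone by linarith
    then have "v < b - a" using ab by simp
    ultimately have "E v u w \<in> triangle_elements a b \<rho>"
      unfolding triangle_elements_altdef u using 4 cone by (force simp: algebra_simps)
    then show ?thesis
      unfolding associated_to_triangle_def using unit1 by force
  qed
qed

text \<open>The coefficient of \<open>\<rho>\<kappa>\<^sup>2\<close> is the integer
  \<open>a * v - w\<close>. If it is 0, the element lies on the facet shared with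
  \<open>C\<^sub>1\<close>; if it is at least 1, that generator can be subtracted, so the element
  equals it.\<close>

lemma associated_cone2:
  assumes x: "indecomposable \<rho> (E v u w)"
    and cone: "0 \<le> a * v - w" "a * (b - a) * (a * v - w) \<le> v" "v \<le> (b - a) * u"
  shows "associated_to_triangle (E v u w)"
proof (cases "a * v - w = 0")
  case True
  then have w: "w = a * v" by simp
  have "a * v \<le> a * ((b - a) * u)" using ab cone by (intro mult_left_mono) auto
  then show ?thesis using x cone True ab
    by (intro associated_cone1) (auto simp: w mult.assoc)
next
  case False
  let ?v = "a * (b - a)" and ?w = "a * a * (b - a) - 1"
  have unit: "totally_positive_unit \<rho> (\<rho> * kappa\<^sup>2)"
    by (rule totally_positive_unit_mult[OF unit_rho unit_kappa_sq])
  then have "TP (E ?v a ?w)" by (simp add: E_rho_kappa_sq totally_positive_unit_def)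
  then have "\<not> TP (E (v - ?v) (u - a) (w - ?w))" by (rule indecomposable_not_TP_diff[OF x])
  moreover have "a * (v - ?v) - (w - ?w) = a * v - w - 1" by (simp add: algebra_simps)
  ultimately have "(v - ?v, u - a, w - ?w) = (0, 0, 0)"
    using TP_cone2[of "v - ?v" "w - ?w" "u - a"] cone False by (fastforce simp: algebra_simps)
  then show ?thesis using associated_unit[OF unit] E_rho_kappa_sq by simp
qed

text \<open>The disjunction on \<open>n\<close> makes one strong induction cover both forms, so that
  a descent step may switch from one to the other.\<close>

lemma indecomposable_associated_E:
  assumes "indecomposable \<rho> (E v u w)"
    and "n = nat (a * u - (a * v - w)) \<or> n = nat (a * (u - (a - 1) * (a * v - w)))"
  shows "associated_to_triangle (E v u w)"
  using assms
proof (induction n arbitrary: v u w rule: less_induct)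
  case (less n)
  \<comment> \<open>\<open>f\<close> is \<open>\<psi>\<^sub>1\<close> and \<open>g\<close> is
    \<open>\<psi>\<^sub>2\<close>.\<close>
  define f where "f v u w = a * u - (a * v - w)" for v u w
  define g where "g v u w = a * (u - (a - 1) * (a * v - w))" for v u w
  have IHf: "associated_to_triangle (E v' u' w')"
    if "indecomposable \<rho> (E v' u' w')" "nat (f v' u' w') < n" for v' u' w'
    using less.IH that by (auto simp: f_def)
  have IHg: "associated_to_triangle (E v' u' w')"
    if "indecomposable \<rho> (E v' u' w')" "nat (g v' u' w') < n" for v' u' w'
    using less.IH that by (auto simp: g_def)
  have fpos: "0 < f v u w" and gpos: "0 < g v u w"
    using less.prems(1) TP_bounds[of v u w] ab by (auto simp: indecomposable_def f_def g_def)
  let ?d = "b - a" and ?e = "a * v - w"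
  have "1 * 2 \<le> a * ?d" using ab by (intro mult_mono) auto
  then have D: "0 < a * ?d - 1" by simp
  have "1 * 2 \<le> (a - 1) * a" using ab by (intro mult_mono) auto
  then have A: "0 < a * a - a - 1" by (simp add: algebra_simps)
  \<comment> \<open>A unit translate with a smaller value of either form settles the claim by
    induction; below, its failure gives the minimality inequalities.\<close>
  have transport: "associated_to_triangle (E v u w)"
    if "totally_positive_unit \<rho> \<epsilon>" "\<epsilon> * E v u w = E v' u' w'"
      "nat (f v' u' w') < n \<or> nat (g v' u' w') < n" for \<epsilon> v' u' w'
  proof -
    have "indecomposable \<rho> (E v' u' w')"
      using indecomposable_unit_mult[OF that(1) less.prems(1)] that(2) by simp
    then have "associated_to_triangle (\<epsilon> * E v u w)"
      unfolding that(2) using that(3) IHf IHg by blast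
    then show ?thesis by (rule associated_unit_mult[OF that(1)])
  qed
  note \<rho>x = rho_mult[of v u w] and \<rho>inv_x = rho_inv_mult[of v u w]
  have \<kappa>x: "kappa\<^sup>2 * E v u w = E (w + ?d * (- v + a * u + a * ?d * w)) (- v + a * u + a * ?d * w)
      (- (u + ?d * w) + a * w + a * ?d * (- v + a * u + a * ?d * w))"
    by (simp add: power2_eq_square mult.assoc kappa_mult)
  have \<kappa>inv_x: "kappa_inv\<^sup>2 * E v u w = E (a * ?e - u) (?e - ?d * (v - ?d * u)) (v - ?d * u)"
    by (simp add: power2_eq_square mult.assoc kappa_inv_mult)
  from less.prems(2) consider "int n = f v u w" | "int n = g v u w"
    using fpos gpos by (auto simp: f_def g_def)
  then show ?case
  proof cases
    case n: 1
    show ?thesis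
    proof (rule ccontr)
      assume na: "\<not> ?thesis"
      \<comment> \<open>The cones \<open>C\<^sub>1\<close> and \<open>C\<^sub>2\<close> meet in the
        facet spanned by \<rho> and \<open>\<kappa>\<^sup>2\<close>, where \<open>?e\<close>
        vanishes.\<close>
      have "g v u w - f v u w = - ((a * a - a - 1) * ?e)" by (simp add: f_def g_def algebra_simps)
      moreover have "f v u w \<le> g v u w" using IHg[OF less.prems(1)] na n gpos by linarith
      ultimately have "(a * a - a - 1) * ?e \<le> 0" by linarith
      then have e: "?e \<le> 0" using A by (simp add: mult_le_0_iff)
      \<comment> \<open>As a form in the original element this belongs to \<open>C\<^sub>2\<close>
        divided by \<rho>, which shares the facet spanned by 1 and
        \<open>\<kappa>\<^sup>2\<close>.\<close>
      have "f v u w \<le> g w (b * u - v) (a * w - u)"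
        using transport[OF unit_rho \<rho>x] na n fpos by linarith
      then have w: "w \<le> a * ?d * u" by (simp add: f_def g_def algebra_simps)
      \<comment> \<open>Dividing \<open>C\<^sub>2\<close> by \<open>\<kappa>\<^sup>2\<close> gives
        the neighbour across the facet spanned by 1 and \<rho>.\<close>
      have "f v u w \<le> g (w + ?d * (- v + a * u + a * ?d * w)) (- v + a * u + a * ?d * w)
          (- (u + ?d * w) + a * w + a * ?d * (- v + a * u + a * ?d * w))"
        using transport[OF unit_kappa_sq \<kappa>x] na n fpos by linarith
      also have "\<dots> = f v u w + (a * ?d - 1) * w" by (simp add: f_def g_def algebra_simps)
      finally have "0 \<le> w" using D by (simp add: zero_le_mult_iff)
      then show False using associated_cone1[OF less.prems(1)] e w na by simp
    qed
  next
    case n: 2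
    show ?thesis
    proof (rule ccontr)
      assume na: "\<not> ?thesis"
      have "g v u w - f v u w = - ((a * a - a - 1) * ?e)" by (simp add: f_def g_def algebra_simps)
      moreover have "g v u w \<le> f v u w" using IHf[OF less.prems(1)] na n fpos by linarith
      ultimately have "0 \<le> (a * a - a - 1) * ?e" by linarith
      then have e: "0 \<le> ?e" using A by (simp add: zero_le_mult_iff)
      \<comment> \<open>The neighbour is now \<rho> times \<open>C\<^sub>1\<close>, across the facet
        spanned by \<rho> and \<open>\<rho>\<kappa>\<^sup>2\<close>.\<close>
      have "g v u w \<le> f (b * ?e - u) ?e v"
        using transport[OF unit_rho_inv \<rho>inv_x] na n gpos by linarith
      then have v: "a * ?d * ?e \<le> v" by (simp add: f_def g_def algebra_simps)
      \<comment> \<open>The last neighbour is \<open>\<kappa>\<^sup>2\<close> times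
        \<open>C\<^sub>1\<close>, across the facet spanned by \<open>\<kappa>\<^sup>2\<close> and
        \<open>\<rho>\<kappa>\<^sup>2\<close>.\<close>
      have "g v u w \<le> f (a * ?e - u) (?e - ?d * (v - ?d * u)) (v - ?d * u)"
        using transport[OF unit_kappa_inv_sq \<kappa>inv_x] na n gpos by linarith
      also have "\<dots> = g v u w + (a * ?d - 1) * (?d * u - v)" by (simp add: f_def g_def algebra_simps)
      finally have "v \<le> ?d * u" using D by (simp add: zero_le_mult_iff)
      then show False using associated_cone2[OF less.prems(1)] e v na by simp
    qed
  qed
qed

lemma indecomposable_associated:
  assumes "indecomposable \<rho> \<alpha>"
  shows "associated_to_triangle \<alpha>"
proof -
  obtain v u w where "\<alpha> = E v u w"
    using assms Z_adjoinE unfolding indecomposable_def by blast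
  then show ?thesis using assms indecomposable_associated_E by blast
qed

end

theorem proposition5p3:
  fixes a b :: int and \<rho> :: "'a::field_char_0"
  assumes "2 \<le> a" and "a \<le> b - 2"
    and "poly (map_poly of_int (cubic a b)) \<rho> = 0"
  shows "(\<forall>\<alpha> \<in> triangle_elements a b \<rho>. indecomposable \<rho> \<alpha>) \<and>
         (\<forall>\<alpha>. indecomposable \<rho> \<alpha> \<longrightarrow>
            (\<exists>\<tau> \<in> triangle_elements a b \<rho>. \<exists>\<epsilon>. totally_positive_unit \<rho> \<epsilon> \<and> \<alpha> = \<epsilon> * \<tau>))"
proof -
  interpret cubic_root a b \<rho> by unfold_locales (fact assms)+
  show ?thesis
    using triangle_indecomposable indecomposable_associated
    unfolding associated_to_triangle_def by blast
qed

end
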